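(* For every integer $m\ge0$, $$\sum_{n=0}^{\infty}(-1)^n\frac{1}{16^n}\binom{2n}{n}^2\frac{1}{2n+m+1}=\frac{2}{\pi}\int_0^1\frac{x^m}{\sqrt{1+x^2}}\,K\!\left(\frac{x}{\sqrt{1+x^2}}\right)dx .$$ If $m=2\ell+1$ with $\ell$ a non-negative integer, the series equals $$\frac12\sum_{n=0}^{\infty}(-1)^n\frac{1}{16^n}\binom{2n}{n}^2\frac{1}{n+\ell+1}.$$ If $m=2\ell$ with $\ell$ a non-negative integer, then $$\sum_{n=0}^{\infty}(-1)^n\frac{1}{16^n}\binom{2n}{n}^2\frac{1}{2n+2\ell+1}=\frac{(-1)^\ell\binom{2\ell}{\ell}^2}{16^\ell}\left(\frac12\Phi-\frac{1}{8\sqrt2\,\pi^{3/2}}\sum_{j=1}^{\ell}(-1)^{j-1}\frac{16^j}{j^2\binom{2j}{j}^2}\left\{(4j-1)\,\Gamma\!\left(\tfrac14\right)^2-4\,\Gamma\!\left(\tfrac34\right)^2\right\}\right),$$ where $\Phi=\Phi_{0,-1}\left(-\tfrac12;\tfrac12,\tfrac12,1\right)=\int_0^1x^{-1/2}\,{}_2F_1\left(\tfrac12,\tfrac12;1;-x\right)dx$.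
   Context: $K(k)=\int_0^{\pi/2}\frac{d\theta}{\sqrt{1-k^2\sin^2\theta}}$ is the complete elliptic integral of the first kind in the modulus convention. ${}_2F_1$ is the Gauss hypergeometric function. *)

theory Defs
  imports "HOL-Analysis.Analysis"
begin

text \<open>Modulus convention: the argument is \<open>k\<close>, not the parameter \<open>k\<^sup>2\<close>.
  Meaningful for \<open>\<bar>k\<bar> < 1\<close>, where the integrand is continuous on the whole interval.\<close>

definition elliptic_K :: "real \<Rightarrow> real" where
  "elliptic_K k = integral {0..pi/2} (\<lambda>\<theta>. 1 / sqrt (1 - k\<^sup>2 * (sin \<theta>)\<^sup>2))"

text \<open>The sum of the Gauss series
  \<open>(\<Sum>n. pochhammer a n * pochhammer b n / (pochhammer c n * fact n) * z ^ n)\<close>,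
  hence meaningful where that series converges.  For \<open>a = b = 1/2\<close> and \<open>c = 1\<close> this includes
  \<open>-1 \<le> z \<le> 0\<close>; at \<open>z = -1\<close> the convergence is only conditional, and by Abel's theorem the sum
  agrees with the value of the analytic continuation.\<close>

definition hypergeo_2F1 :: "real \<Rightarrow> real \<Rightarrow> real \<Rightarrow> real \<Rightarrow> real" where
  "hypergeo_2F1 a b c z = eval_fps (fps_hypergeo [a, b] [c] 1) z"

end

theory Submission
  imports Defs
begin

text \<open>
  Write \<open>b n = pochhammer (1/2) n / fact n\<close>, which equals \<open>((2*n) choose n) / 4^n\<close>.  The series in
  question is \<open>\<Sum>n. (-1)^n * (b n)\<^sup>2 / (2*n + m + 1)\<close>, the \<open>m\<close>-th moment over \<open>[0, 1]\<close> of \<open>f (x\<^sup>2)\<close>, where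
  \<open>f x = (\<Sum>n. (-1)^n * (b n)\<^sup>2 * x^n)\<close> is \<open>\<^sub>2F\<^sub>1(1/2, 1/2; 1; -x)\<close>.

  The coefficients \<open>b n\<close> decrease to \<open>0\<close>, so Leibniz' criterion makes the alternating series
  converge uniformly on the closed interval \<open>[0, 1]\<close>, the endpoint included.  All
  interchanges of sum and integral are instances of \<open>sums_integral_alt_series\<close>.  Integrating the binomial series of
  \<open>1 / sqrt (1 + x * (cos \<theta>)\<^sup>2)\<close> termwise and using Wallis' integral gives
  \<open>pi / 2 * f x\<close> (\<open>integral_hypergeo_half\<close>); with \<open>x\<^sup>2\<close> in place of \<open>x\<close>, the integral over \<open>\<theta>\<close> is
  \<open>K (x / sqrt (1 + x\<^sup>2)) / sqrt (1 + x\<^sup>2)\<close>.  This settles the integral formula; the odd case only takes out a factor 2.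

  For even \<open>m\<close>, the hypergeometric differential equation yields a first-order inhomogeneous
  recurrence between consecutive even moments.  Its inhomogeneity involves \<open>f 1\<close> and \<open>f' 1\<close>; the
  derivative is replaced by a multiple of \<open>\<Sum>n. (-1)^n * (b n)\<^sup>2 / (n + 1)\<close>, and then the recurrence is
  a telescoping identity for the coefficients (\<open>contiguous_sums_zero\<close>).  Both boundary quantities are
  combinations of the lemniscatic integrals of \<open>1 / sqrt (1 - u^4)\<close> and \<open>u\<^sup>2 / sqrt (1 - u^4)\<close> over
  \<open>[0, 1]\<close>, that is, of Beta values, which the reflection formula expresses by \<open>Gamma (1/4)\<close> and
  \<open>Gamma (3/4)\<close>.  Unrolling the recurrence down to \<open>m = 0\<close>, where \<open>x = u\<^sup>2\<close> identifies the moment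
  with half of \<open>\<Phi>\<close>, gives the closed formula (\<open>moment_even\<close>).
\<close>

section \<open>Alternating power series up to the endpoint\<close>

definition leibniz_coeffs :: "(nat \<Rightarrow> real) \<Rightarrow> bool" where
  "leibniz_coeffs c \<longleftrightarrow> (\<forall>n. 0 \<le> c n) \<and> decseq c \<and> c \<longlonglongrightarrow> 0"

definition alt_series :: "(nat \<Rightarrow> real) \<Rightarrow> real \<Rightarrow> real" where
  "alt_series c y = (\<Sum>n. (-1)^n * c n * y^n)"

text \<open>The terms \<open>c n * y ^ n\<close> are again decreasing and dominated by \<open>c n\<close>, so Leibniz' criterion
  applies for each \<open>y\<close>, with an error bound that does not depend on \<open>y\<close>.  This is what
  makes the endpoint \<open>y = 1\<close> harmless although convergence there may be only conditional.\<close>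

lemma alt_series_summable_remainder:
  assumes c: "leibniz_coeffs c" and y: "0 \<le> y" "y \<le> 1"
  shows "summable (\<lambda>n. (-1)^n * c n * y^n)"
    and "\<bar>alt_series c y - (\<Sum>n<N. (-1)^n * c n * y^n)\<bar> \<le> c N"
proof -
  define a where "a n = c n * y^n" for n
  have c0: "0 \<le> c n" "c (Suc n) \<le> c n" for n
    using c by (auto simp: leibniz_coeffs_def decseq_Suc_iff)
  have ac: "a n \<le> c n" for n
    using y c0 by (simp add: a_def mult_left_le power_le_one)
  have a0: "0 \<le> a n" for n
    using y c0 by (simp add: a_def)
  have adec: "a (Suc n) \<le> a n" for n
    unfolding a_def using y c0 by (intro mult_mono power_decreasing) auto
  have alim: "a \<longlonglongrightarrow> 0"
    using c a0 ac by (intro tendsto_sandwich[of "\<lambda>_. 0" a sequentially c])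
      (auto simp: leibniz_coeffs_def)
  note L = summable_Leibniz'[OF alim a0 adec]
  show "summable (\<lambda>n. (-1)^n * c n * y^n)"
    using L(1) by (simp add: a_def mult.assoc)
  let ?P = "\<lambda>N. \<Sum>n<N. (-1)^n * a n"
  have S: "alt_series c y = (\<Sum>n. (-1)^n * a n)"
    by (simp add: alt_series_def a_def mult.assoc)
  have "\<bar>(\<Sum>n. (-1)^n * a n) - ?P N\<bar> \<le> a N"
  proof (cases "even N")
    case True
    then obtain k where k: "N = 2 * k" by blast
    show ?thesis using L(2)[of k] L(4)[of k] by (simp add: k)
  next
    case False
    then obtain k where k: "N = 2 * k + 1" by (auto elim: oddE)
    show ?thesis using L(2)[of "Suc k"] L(4)[of k] by (simp add: k)
  qed
  with ac[of N] show "\<bar>alt_series c y - (\<Sum>n<N. (-1)^n * c n * y^n)\<bar> \<le> c N"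
    unfolding S by (simp add: a_def mult.assoc)
qed

lemma uniform_limit_alt_series:
  assumes c: "leibniz_coeffs c"
  shows "uniform_limit {0..1} (\<lambda>N y. \<Sum>n<N. (-1)^n * c n * y^n) (alt_series c) sequentially"
proof (rule uniform_limitI)
  fix e :: real assume "e > 0"
  with c have "eventually (\<lambda>N. c N < e) sequentially"
    by (auto simp: leibniz_coeffs_def order_tendsto_iff)
  then show "\<forall>\<^sub>F N in sequentially. \<forall>y\<in>{0..1}.
      dist (\<Sum>n<N. (-1)^n * c n * y^n) (alt_series c y) < e"
  proof eventually_elim
    case (elim N)
    show ?case
    proof
      fix y :: real assume "y \<in> {0..1}"
      then have "\<bar>alt_series c y - (\<Sum>n<N. (-1)^n * c n * y^n)\<bar> \<le> c N"
        by (intro alt_series_summable_remainder[OF c]) auto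
      with elim show "dist (\<Sum>n<N. (-1)^n * c n * y^n) (alt_series c y) < e"
        by (simp add: dist_real_def)
    qed
  qed
qed

lemma continuous_on_alt_series:
  assumes "leibniz_coeffs c"
  shows "continuous_on {0..1} (alt_series c)"
  by (rule uniform_limit_theorem[OF _ uniform_limit_alt_series[OF assms]])
     (auto intro!: always_eventually continuous_intros)

text \<open>Termwise integration.  It serves twice: with \<open>g\<close> a multiple of \<open>cos\<^sup>2\<close> it turns the binomial
  series into the hypergeometric one, and with \<open>g x = x\<^sup>2\<close> it produces the moments.\<close>

lemma sums_integral_alt_series:
  fixes w g :: "real \<Rightarrow> real"
  assumes c: "leibniz_coeffs c"
    and w: "continuous_on {a..b} w" and g: "continuous_on {a..b} g"
    and g01: "\<And>x. x \<in> {a..b} \<Longrightarrow> g x \<in> {0..1}"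
  shows "(\<lambda>n. (-1)^n * c n * integral {a..b} (\<lambda>x. w x * g x ^ n)) sums
           integral {a..b} (\<lambda>x. w x * alt_series c (g x))"
proof -
  have "uniform_limit {a..b} (\<lambda>N x. \<Sum>n<N. (-1)^n * c n * g x ^ n)
          (\<lambda>x. alt_series c (g x)) sequentially"
    using uniform_limit_compose'[OF uniform_limit_alt_series[OF c], of g "{a..b}"] g01 by auto
  moreover have "bounded (w ` {a..b})"
    using w by (intro compact_imp_bounded compact_continuous_image) auto
  moreover have "bounded ((\<lambda>x. alt_series c (g x)) ` {a..b})"
  proof (intro compact_imp_bounded compact_continuous_image)
    show "continuous_on {a..b} (\<lambda>x. alt_series c (g x))"
      using g01 by (intro continuous_on_compose2[OF continuous_on_alt_series[OF c] g]) auto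
  qed auto
  ultimately have u: "uniform_limit {a..b} (\<lambda>N x. w x * (\<Sum>n<N. (-1)^n * c n * g x ^ n))
          (\<lambda>x. w x * alt_series c (g x)) sequentially"
    by (intro uniform_lim_mult uniform_limit_const) auto
  have cont: "continuous_on {a..b} (\<lambda>x. w x * (\<Sum>n<N. (-1)^n * c n * g x ^ n))" for N
    by (intro continuous_intros w g)
  obtain I J where I: "\<And>N. ((\<lambda>x. w x * (\<Sum>n<N. (-1)^n * c n * g x ^ n)) has_integral I N) {a..b}"
    and J: "((\<lambda>x. w x * alt_series c (g x)) has_integral J) {a..b}" and IJ: "I \<longlonglongrightarrow> J"
    using uniform_limit_integral[OF u cont] by auto
  have IN: "I N = (\<Sum>n<N. (-1)^n * c n * integral {a..b} (\<lambda>x. w x * g x ^ n))" for N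
  proof -
    have "((\<lambda>x. \<Sum>n<N. (-1)^n * c n * (w x * g x ^ n)) has_integral
            (\<Sum>n<N. (-1)^n * c n * integral {a..b} (\<lambda>x. w x * g x ^ n))) {a..b}"
      by (intro has_integral_sum has_integral_mult_right integrable_integral
            integrable_continuous_real continuous_intros w g) auto
    moreover have "(\<lambda>x. \<Sum>n<N. (-1)^n * c n * (w x * g x ^ n)) =
        (\<lambda>x. w x * (\<Sum>n<N. (-1)^n * c n * g x ^ n))"
      by (simp add: sum_distrib_left mult_ac)
    ultimately show ?thesis
      using has_integral_unique[OF I[of N]] by simp
  qed
  have "I = (\<lambda>N. \<Sum>n<N. (-1)^n * c n * integral {a..b} (\<lambda>x. w x * g x ^ n))"
    by (rule ext) (rule IN)
  with IJ J show ?thesis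
    by (simp add: sums_def integral_unique)
qed

section \<open>The binomial series with exponent \<open>-1/2\<close>\<close>

definition half_coeff :: "nat \<Rightarrow> real" where
  "half_coeff n = pochhammer (1/2) n / fact n"

lemma half_coeff_0 [simp]: "half_coeff 0 = 1"
  by (simp add: half_coeff_def)

lemma half_coeff_Suc: "half_coeff (Suc n) = half_coeff n * ((2 * real n + 1) / (2 * real n + 2))"
  by (simp add: half_coeff_def pochhammer_Suc divide_simps) (simp add: algebra_simps)

lemma half_coeff_pos: "half_coeff n > 0"
  by (simp add: half_coeff_def pochhammer_pos)

lemma half_coeff_eq_central_binomial: "half_coeff n = real ((2 * n) choose n) / 4 ^ n"
proof -
  have "real ((2 * n) choose n) = fact (2 * n) / (fact n * fact n)"
    by (subst binomial_fact) auto
  then show ?thesis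
    by (simp add: half_coeff_def fact_double power_mult)
qed

lemma half_coeff_squared: "(half_coeff n)\<^sup>2 = (real ((2 * n) choose n))\<^sup>2 / 16 ^ n"
  by (simp add: half_coeff_eq_central_binomial power_divide power2_eq_square
      flip: power_mult_distrib)

text \<open>Wallis-type decay \<open>(half_coeff n)\<^sup>2 \<le> 1 / (2 * n + 1)\<close>, by induction from the quotient of
  consecutive coefficients.\<close>

lemma leibniz_half_coeff: "leibniz_coeffs half_coeff"
proof -
  have bound: "(half_coeff n)\<^sup>2 \<le> 1 / (2 * real n + 1)" for n
  proof (induction n)
    case (Suc n)
    have "(half_coeff (Suc n))\<^sup>2 = (half_coeff n)\<^sup>2 * ((2 * real n + 1) / (2 * real n + 2))\<^sup>2"
      by (simp only: half_coeff_Suc power_mult_distrib)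
    also have "\<dots> \<le> 1 / (2 * real n + 1) * ((2 * real n + 1) / (2 * real n + 2))\<^sup>2"
      by (intro mult_right_mono Suc) auto
    also have "\<dots> = (2 * real n + 1) / (2 * real n + 2)\<^sup>2"
      by (simp add: power_divide power2_eq_square)
    also have "\<dots> \<le> 1 / (2 * real (Suc n) + 1)"
      by (simp add: divide_simps power2_eq_square) (simp add: algebra_simps)
    finally show ?case .
  qed auto
  have "(half_coeff n)\<^sup>2 \<le> inverse (real (Suc n))" for n
    using bound[of n] by (rule order_trans) (simp add: divide_simps)
  then have "(\<lambda>n. (half_coeff n)\<^sup>2) \<longlonglongrightarrow> 0"
    by (intro tendsto_sandwich[OF _ _ tendsto_const LIMSEQ_inverse_real_of_nat]) auto
  then have "half_coeff \<longlonglongrightarrow> 0" by simp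
  moreover have "half_coeff (Suc n) \<le> half_coeff n" for n
    using half_coeff_pos[of n] by (simp add: half_coeff_Suc divide_simps)
  ultimately show ?thesis
    by (auto simp: leibniz_coeffs_def decseq_Suc_iff intro: less_imp_le half_coeff_pos)
qed

lemma leibniz_coeffs_squared:
  assumes "leibniz_coeffs c"
  shows "leibniz_coeffs (\<lambda>n. (c n)\<^sup>2)"
  using assms
  by (auto simp: leibniz_coeffs_def decseq_Suc_iff intro!: power_mono tendsto_eq_intros)

text \<open>Inside the interval this is the binomial theorem; the value at \<open>y = 1\<close> follows because both
  sides are continuous on the closed interval.\<close>

lemma alt_series_half_coeff:
  assumes "y \<in> {0..1}"
  shows "alt_series half_coeff y = 1 / sqrt (1 + y)"
proof -
  have inner: "alt_series half_coeff y - 1 / sqrt (1 + y) = 0" if "y \<in> {0..<1}" for y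
  proof -
    have "(\<lambda>n. ((-1/2) gchoose n) * y ^ n) sums (1 + y) powr (-1/2)"
      using that by (intro gen_binomial_real) auto
    moreover have "(-1/2 :: real) gchoose n = (-1)^n * half_coeff n" for n
      by (simp add: gbinomial_pochhammer half_coeff_def)
    ultimately have "alt_series half_coeff y = (1 + y) powr (-1/2)"
      by (simp add: alt_series_def sums_iff)
    then show ?thesis
      using that powr_minus_divide[of "1 + y" "1/2"] by (simp add: powr_half_sqrt)
  qed
  have cl: "closure {0..<1::real} = {0..1}" by simp
  have "continuous_on {0..1} (\<lambda>y. alt_series half_coeff y - 1 / sqrt (1 + y))"
    by (intro continuous_intros continuous_on_alt_series leibniz_half_coeff) auto
  then have "alt_series half_coeff y - 1 / sqrt (1 + y) = 0"
    using continuous_constant_on_closure[of "{0..<1::real}"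
            "\<lambda>y. alt_series half_coeff y - 1 / sqrt (1 + y)" 0 y] inner assms
    unfolding cl by auto
  then show ?thesis by simp
qed

text \<open>Wallis' integral: differentiating \<open>sin \<theta> * cos \<theta> ^ (2 * n + 1)\<close>, which vanishes at both ends,
  gives the recurrence satisfied by \<open>half_coeff\<close>.\<close>

lemma integral_cos_power_even:
  "((\<lambda>\<theta>. (cos \<theta>)\<^sup>2 ^ n) has_integral (pi / 2 * half_coeff n)) {0..pi/2}"
proof (induction n)
  case 0
  show ?case using has_integral_const_real[of "1::real" 0 "pi/2"] by simp
next
  case (Suc n)
  have "((\<lambda>\<theta>. (2 * real n + 2) * (cos \<theta>)\<^sup>2 ^ Suc n - (2 * real n + 1) * (cos \<theta>)\<^sup>2 ^ n)
      has_integral (sin (pi/2) * cos (pi/2) ^ (2 * n + 1) - sin 0 * cos 0 ^ (2 * n + 1))) {0..pi/2}"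
  proof (rule fundamental_theorem_of_calculus)
    fix \<theta> :: real
    have "((\<lambda>\<theta>. sin \<theta> * cos \<theta> ^ (2 * n + 1)) has_real_derivative
        cos \<theta> * cos \<theta> ^ (2 * n + 1) - sin \<theta> * (real (2 * n + 1) * cos \<theta> ^ (2 * n) * sin \<theta>)) (at \<theta>)"
      by (rule derivative_eq_intros refl)+ simp
    moreover have "cos \<theta> * cos \<theta> ^ (2 * n + 1) - sin \<theta> * (real (2 * n + 1) * cos \<theta> ^ (2 * n) * sin \<theta>)
        = (cos \<theta>)\<^sup>2 * ((cos \<theta>)\<^sup>2 ^ n) - (2 * real n + 1) * (sin \<theta>)\<^sup>2 * (cos \<theta>)\<^sup>2 ^ n"
      by (simp add: power2_eq_square power_mult)
    moreover have "\<dots> = (2 * real n + 2) * (cos \<theta>)\<^sup>2 ^ Suc n - (2 * real n + 1) * (cos \<theta>)\<^sup>2 ^ n"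
      by (simp add: sin_squared_eq algebra_simps)
    ultimately show "((\<lambda>\<theta>. sin \<theta> * cos \<theta> ^ (2 * n + 1)) has_vector_derivative
        (2 * real n + 2) * (cos \<theta>)\<^sup>2 ^ Suc n - (2 * real n + 1) * (cos \<theta>)\<^sup>2 ^ n) (at \<theta> within {0..pi/2})"
      by (simp add: has_real_derivative_iff_has_vector_derivative[symmetric] has_field_derivative_at_within)
  qed auto
  from has_integral_add[OF this has_integral_mult_right[OF Suc, of "2 * real n + 1"]]
  have "((\<lambda>\<theta>. (2 * real n + 2) * (cos \<theta>)\<^sup>2 ^ Suc n) has_integral
      (2 * real n + 1) * (pi / 2 * half_coeff n)) {0..pi/2}"
    by simp
  from has_integral_mult_right[OF this, of "1 / (2 * real n + 2)"]
  show ?case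
    by (simp add: half_coeff_Suc mult_ac add_nonneg_eq_0_iff)
qed

section \<open>The hypergeometric function and its moments\<close>

text \<open>This is \<open>x \<mapsto> \<^sub>2F\<^sub>1(1/2, 1/2; 1; -x)\<close> on \<open>[0, 1]\<close>.\<close>

abbreviation hypergeo_half :: "real \<Rightarrow> real" where
  "hypergeo_half \<equiv> alt_series (\<lambda>n. (half_coeff n)\<^sup>2)"

lemma leibniz_half_coeff_squared: "leibniz_coeffs (\<lambda>n. (half_coeff n)\<^sup>2)"
  by (rule leibniz_coeffs_squared[OF leibniz_half_coeff])

lemma hypergeo_2F1_eq: "hypergeo_2F1 (1/2) (1/2) 1 (-x) = hypergeo_half x"
proof -
  have "fps_nth (fps_hypergeo [1/2, 1/2] [1] 1) n * (-x)^n = (-1)^n * (half_coeff n)\<^sup>2 * x^n" for n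
    by (subst power_minus) (simp add: half_coeff_def power2_eq_square pochhammer_fact[symmetric])
  then show ?thesis
    by (simp only: hypergeo_2F1_def eval_fps_def alt_series_def)
qed

text \<open>Each power of \<open>cos\<^sup>2\<close> in the binomial series of the integrand contributes one more factor
  \<open>half_coeff n\<close> by Wallis, which squares the coefficients.\<close>

lemma integral_hypergeo_half:
  assumes y: "y \<in> {0..1}"
  shows "integral {0..pi/2} (\<lambda>\<theta>. 1 / sqrt (1 + y * (cos \<theta>)\<^sup>2)) = pi / 2 * hypergeo_half y"
proof -
  let ?g = "\<lambda>\<theta>. y * (cos \<theta>)\<^sup>2"
  have g01: "?g \<theta> \<in> {0..1}" for \<theta>
    using y by (auto intro!: mult_le_one simp: abs_square_le_1)
  have "(\<lambda>n. (-1)^n * half_coeff n * integral {0..pi/2} (\<lambda>\<theta>. 1 * ?g \<theta> ^ n)) sums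
          integral {0..pi/2} (\<lambda>\<theta>. 1 * alt_series half_coeff (?g \<theta>))"
    by (rule sums_integral_alt_series[OF leibniz_half_coeff]) (use g01 in \<open>auto intro!: continuous_intros\<close>)
  moreover have "integral {0..pi/2} (\<lambda>\<theta>. 1 * ?g \<theta> ^ n) = y ^ n * (pi / 2 * half_coeff n)" for n
    using integral_unique[OF has_integral_mult_right[OF integral_cos_power_even, of "y ^ n" n]]
    by (simp add: power_mult_distrib)
  moreover have "alt_series half_coeff (?g \<theta>) = 1 / sqrt (1 + ?g \<theta>)" for \<theta>
    by (rule alt_series_half_coeff[OF g01])
  ultimately have "(\<lambda>n. (-1)^n * half_coeff n * (y ^ n * (pi / 2 * half_coeff n))) sums
      integral {0..pi/2} (\<lambda>\<theta>. 1 / sqrt (1 + ?g \<theta>))"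
    by (simp only: mult_1)
  moreover have "(\<lambda>n. pi / 2 * ((-1)^n * (half_coeff n)\<^sup>2 * y ^ n)) sums (pi / 2 * hypergeo_half y)"
    unfolding alt_series_def using y
    by (intro sums_mult summable_sums alt_series_summable_remainder(1) leibniz_half_coeff_squared) auto
  ultimately show ?thesis
    by (simp add: sums_iff power2_eq_square mult_ac)
qed

text \<open>With \<open>k = x / sqrt (1 + x\<^sup>2)\<close> one has
  \<open>1 - k\<^sup>2 * (sin \<theta>)\<^sup>2 = (1 + x\<^sup>2 * (cos \<theta>)\<^sup>2) / (1 + x\<^sup>2)\<close>,
  so the factor \<open>sqrt (1 + x\<^sup>2)\<close> cancels and the previous integral remains.\<close>

lemma elliptic_K_eq_hypergeo_half:
  assumes x: "x \<in> {0..1}"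
  shows "elliptic_K (x / sqrt (1 + x\<^sup>2)) / sqrt (1 + x\<^sup>2) = pi / 2 * hypergeo_half (x\<^sup>2)"
proof -
  have pos: "1 + x\<^sup>2 > 0" by (simp add: add_pos_nonneg)
  have "1 / sqrt (1 - (x / sqrt (1 + x\<^sup>2))\<^sup>2 * (sin \<theta>)\<^sup>2) =
      sqrt (1 + x\<^sup>2) * (1 / sqrt (1 + x\<^sup>2 * (cos \<theta>)\<^sup>2))" for \<theta>
  proof -
    have "1 - (x / sqrt (1 + x\<^sup>2))\<^sup>2 * (sin \<theta>)\<^sup>2 = (1 + x\<^sup>2 * (cos \<theta>)\<^sup>2) / (1 + x\<^sup>2)"
      using pos by (simp add: power_divide sin_squared_eq field_simps)
    then show ?thesis by (simp add: real_sqrt_divide)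
  qed
  then have "elliptic_K (x / sqrt (1 + x\<^sup>2)) =
      sqrt (1 + x\<^sup>2) * integral {0..pi/2} (\<lambda>\<theta>. 1 / sqrt (1 + x\<^sup>2 * (cos \<theta>)\<^sup>2))"
    unfolding elliptic_K_def by (simp only: integral_mult_right)
  also have "\<dots> = sqrt (1 + x\<^sup>2) * (pi / 2 * hypergeo_half (x\<^sup>2))"
    using x by (subst integral_hypergeo_half) (auto simp: power_le_one)
  finally show ?thesis using pos by simp
qed

definition moment :: "nat \<Rightarrow> real" where
  "moment m = integral {0..1} (\<lambda>x. x ^ m * hypergeo_half (x\<^sup>2))"

lemma sums_moment:
  "(\<lambda>n. (-1)^n * (half_coeff n)\<^sup>2 * (1 / (2 * real n + real m + 1))) sums moment m"
proof -
  have "(\<lambda>n. (-1)^n * (half_coeff n)\<^sup>2 * integral {0..1} (\<lambda>x. x ^ m * (x\<^sup>2) ^ n)) sums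
     integral {0..1} (\<lambda>x. x ^ m * hypergeo_half (x\<^sup>2))"
    by (rule sums_integral_alt_series[OF leibniz_half_coeff_squared])
       (auto intro!: continuous_intros simp: power_le_one)
  moreover have "integral {0..1} (\<lambda>x::real. x ^ m * (x\<^sup>2) ^ n) = 1 / (2 * real n + real m + 1)" for n
  proof -
    have "((\<lambda>x::real. x ^ (m + 2 * n)) has_integral
        (1 ^ Suc (m + 2 * n) / real (Suc (m + 2 * n)) - 0 ^ Suc (m + 2 * n) / real (Suc (m + 2 * n)))) {0..1}"
      by (rule fundamental_theorem_of_calculus)
         (auto intro!: derivative_eq_intros simp: has_real_derivative_iff_has_vector_derivative[symmetric]
           simp del: power_Suc of_nat_Suc)
    then show ?thesis
      by (simp add: integral_unique power_add power_mult add_ac)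
  qed
  ultimately show ?thesis by (simp add: moment_def)
qed

text \<open>The substitution \<open>x = u\<^sup>2\<close> removes the singularity of \<open>x powr (-1/2)\<close> at \<open>0\<close>.\<close>

lemma integral_powr_hypergeo_half:
  "integral {0..1} (\<lambda>x. x powr (-1/2) * hypergeo_half x) = 2 * moment 0"
proof -
  let ?f = "\<lambda>u. hypergeo_half (u\<^sup>2)"
  have cont: "continuous_on {0..1} ?f"
    by (rule continuous_on_compose2[OF continuous_on_alt_series[OF leibniz_half_coeff_squared]])
       (auto intro!: continuous_intros simp: power_le_one)
  have "((\<lambda>x. (inverse (sqrt x) / 2) *\<^sub>R ?f (sqrt x)) has_integral integral {sqrt 0..sqrt 1} ?f) {0..1}"
    by (rule has_integral_substitution_strong[of "{0}" _ _ _ 0 1])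
       (use cont in \<open>auto intro!: continuous_intros derivative_eq_intros\<close>)
  then have "((\<lambda>x. 2 * ((inverse (sqrt x) / 2) *\<^sub>R ?f (sqrt x))) has_integral 2 * integral {0..1} ?f) {0..1}"
    by (intro has_integral_mult_right) simp
  moreover have "2 * ((inverse (sqrt x) / 2) *\<^sub>R ?f (sqrt x)) = x powr (-1/2) * hypergeo_half x"
    if "x \<in> {0..1}" for x
    using that powr_minus[of x "1/2"] by (simp add: powr_half_sqrt)
  ultimately have "((\<lambda>x. x powr (-1/2) * hypergeo_half x) has_integral 2 * integral {0..1} ?f) {0..1}"
    by (rule has_integral_eq[rotated])
  then show ?thesis by (simp add: integral_unique moment_def)
qed

section \<open>Lemniscatic integrals\<close>

text \<open>Substituting \<open>x = (cos \<theta>) ^ 4\<close> gives a Beta integral, since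
  \<open>1 - (cos \<theta>) ^ 4 = (sin \<theta>)\<^sup>2 * (1 + (cos \<theta>)\<^sup>2)\<close>.  For \<open>p = 0\<close> and \<open>p = 2\<close> these are the classical
  lemniscate integrals of \<open>1 / sqrt (1 - u ^ 4)\<close> and \<open>u\<^sup>2 / sqrt (1 - u ^ 4)\<close> over \<open>[0, 1]\<close>.\<close>

lemma has_integral_lemniscatic:
  "((\<lambda>\<theta>. cos \<theta> ^ p / sqrt (1 + (cos \<theta>)\<^sup>2)) has_integral
      Beta ((real p + 1) / 4) (1/2) / 4) {0..pi/2}"
proof -
  define f where "f = (\<lambda>\<theta>. cos \<theta> ^ p / sqrt (1 + (cos \<theta>)\<^sup>2))"
  define g where "g = (\<lambda>x::real. arccos (x powr (1/4)))"
  define g' where "g' = (\<lambda>x::real. inverse (- sqrt (1 - (x powr (1/4))\<^sup>2)) * (1/4 * x powr (1/4 - 1)))"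
  have pos: "1 + (cos \<theta>)\<^sup>2 > 0" for \<theta> :: real by (simp add: add_pos_nonneg)
  have cont: "continuous_on {0..pi/2} f"
    unfolding f_def using pos by (auto intro!: continuous_intros simp: less_imp_neq[symmetric])
  have le1: "x powr (1/4) \<le> 1" if "x \<in> {0..1}" for x :: real
    using that by (simp add: powr_le1)
  \<comment> \<open>The inverse substitution \<open>g\<close> is decreasing, from \<open>pi/2\<close> to \<open>0\<close>, whence the minus sign below.\<close>
  have "((\<lambda>x. g' x *\<^sub>R f (g x)) has_integral (integral {g 0..g 1} f - integral {g 1..g 0} f)) {0..1}"
  proof (rule has_integral_substitution_general[of "{0,1}" _ _ _ 0 "pi/2"])
    show "g ` {0..1} \<subseteq> {0..pi/2}"
    proof (clarify, unfold g_def)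
      fix x :: real assume "x \<in> {0..1}"
      then have "0 \<le> x powr (1/4)" "x powr (1/4) \<le> 1" using le1 by auto
      then show "arccos (x powr (1/4)) \<in> {0..pi/2}"
        using arccos_le_pi2[of "x powr (1/4)"] arccos_lbound[of "x powr (1/4)"]
          order_trans[of "-1" 0 "x powr (1/4)"] by simp
    qed
    show "continuous_on {0..1} g"
      unfolding g_def using le1
      by (intro continuous_on_arccos continuous_on_powr' continuous_intros)
         (auto intro!: order_trans[OF _ powr_ge_zero])
    fix x :: real assume x: "x \<in> {0..1} - {0, 1}"
    then have "x powr (1/4) < 1"
      using powr_less_mono2[of "1/4" x 1] by auto
    moreover have "-1 < x powr (1/4)"
      by (rule less_le_trans[of _ 0]) auto
    ultimately show "(g has_real_derivative g' x) (at x within {0..1})"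
      unfolding g_def g'_def using x
      by (auto intro!: derivative_eq_intros)
  qed (use cont in auto)
  then have "((\<lambda>x. g' x * f (g x)) has_integral - integral {0..pi/2} f) {0..1}"
    by (simp add: g_def)
  from has_integral_neg[OF this]
  have I: "((\<lambda>x. - (g' x * f (g x))) has_integral integral {0..pi/2} f) {0..1}"
    by simp
  have "- (g' x * f (g x)) = x powr ((real p + 1) / 4 - 1) * (1 - x) powr (1/2 - 1) / 4"
    if x: "x \<in> {0..1} - {0, 1}" for x
  proof -
    define q where "q = x powr (1/4)"
    have q: "0 < q" "q < 1" using x powr_less_mono2[of "1/4" x 1] by (auto simp: q_def)
    have q4: "q ^ 4 = x" "q ^ p = x powr (real p / 4)"
      using x by (auto simp: q_def powr_powr simp flip: powr_realpow)
    have "(1 - q\<^sup>2) * (1 + q\<^sup>2) = 1 - q ^ 4"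
      by (simp add: algebra_simps flip: power_add)
    then have root: "sqrt (1 - q\<^sup>2) * sqrt (1 + q\<^sup>2) = sqrt (1 - x)"
      by (simp add: q4(1) flip: real_sqrt_mult)
    have "cos (g x) = q" using q by (simp add: g_def flip: q_def)
    then have "f (g x) = q ^ p / sqrt (1 + q\<^sup>2)"
      by (simp add: f_def)
    moreover have "g' x = - (x powr (1/4 - 1) / sqrt (1 - q\<^sup>2) / 4)"
      unfolding g'_def by (simp add: inverse_eq_divide flip: q_def)
    ultimately have "- (g' x * f (g x)) = x powr (1/4 - 1) * q ^ p / (sqrt (1 - q\<^sup>2) * sqrt (1 + q\<^sup>2)) / 4"
      by (simp only:) simp
    also have "\<dots> = x powr (1/4 - 1) * x powr (real p / 4) / sqrt (1 - x) / 4"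
      by (simp only: root q4(2))
    also have "x powr (1/4 - 1) * x powr (real p / 4) = x powr ((real p + 1) / 4 - 1)"
      by (simp add: powr_add[symmetric] add_divide_distrib)
    also have "c / sqrt (1 - x) = c * (1 - x) powr (1/2 - 1)" for c
      using x powr_minus_divide[of "1 - x" "1/2"] by (simp add: powr_half_sqrt)
    finally show ?thesis .
  qed
  then have "((\<lambda>x. x powr ((real p + 1) / 4 - 1) * (1 - x) powr (1/2 - 1) / 4)
      has_integral integral {0..pi/2} f) {0..1}"
    by (intro has_integral_spike_finite[OF _ _ I, of "{0,1}"]) auto
  moreover have "((\<lambda>x. x powr ((real p + 1) / 4 - 1) * (1 - x) powr (1/2 - 1) / 4)
      has_integral Beta ((real p + 1) / 4) (1/2) / 4) {0..1}"
    by (intro has_integral_divide has_integral_Beta_real) auto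
  ultimately have "integral {0..pi/2} f = Beta ((real p + 1) / 4) (1/2) / 4"
    by (rule has_integral_unique)
  with integrable_integral[OF integrable_continuous_real[OF cont]]
  have "(f has_integral Beta ((real p + 1) / 4) (1/2) / 4) {0..pi/2}"
    by (simp only:)
  then show ?thesis
    unfolding f_def .
qed

lemma Gamma_quarter_product: "Gamma (1/4) * Gamma (3/4) = pi * sqrt (2::real)"
proof -
  have "complex_of_real (Gamma (1/4) * Gamma (3/4)) = Gamma (1/4) * Gamma (1 - 1/4)"
    by (simp flip: Gamma_complex_of_real)
  also have "\<dots> = of_real pi / sin (of_real pi * (1/4))"
    by (rule Gamma_reflection_complex)
  also have "\<dots> = of_real (pi / sin (pi / 4))"
    by (simp flip: sin_of_real)
  also have "pi / sin (pi / 4) = pi * sqrt 2"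
    by (simp add: sin_45 field_simps)
  finally show ?thesis by (simp only: of_real_eq_iff)
qed

text \<open>The reflection formula at \<open>1/4\<close> eliminates the Gamma value in the denominator.\<close>

lemma Beta_lemniscatic:
  shows "Beta (1/4) (1/2 :: real) = (Gamma (1/4))\<^sup>2 / sqrt (2 * pi)"
    and "Beta (3/4) (1/2 :: real) = 4 * (Gamma (3/4))\<^sup>2 / sqrt (2 * pi)"
proof -
  have pos: "Gamma (1/4 :: real) > 0" "Gamma (3/4 :: real) > 0"
    by (auto intro: Gamma_real_pos)
  have G5: "Gamma (5/4 :: real) = Gamma (1/4) / 4"
    using Gamma_plus1[of "1/4 :: real"] nonpos_Ints_nonpos[of "1/4 :: real"] by force
  have pp: "pi = sqrt pi * sqrt pi" by simp
  have s: "Gamma (1/4) * Gamma (3/4) = sqrt pi * (sqrt (2 * pi) :: real)"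
    unfolding Gamma_quarter_product by (subst pp) (simp only: real_sqrt_mult mult_ac)
  have "Gamma (1/4) * sqrt pi / Gamma (3/4) = (Gamma (1/4))\<^sup>2 / (sqrt (2 * pi) :: real)"
    using pos s by (subst frac_eq_eq) (auto simp: power2_eq_square mult.assoc)
  then show "Beta (1/4) (1/2 :: real) = (Gamma (1/4))\<^sup>2 / sqrt (2 * pi)"
    by (simp add: Beta_def Gamma_one_half_real)
  have "Gamma (3/4) * sqrt pi / (Gamma (1/4) / 4) = 4 * (Gamma (3/4))\<^sup>2 / (sqrt (2 * pi) :: real)"
    using pos s by (subst frac_eq_eq) (auto simp: power2_eq_square mult_ac)
  then show "Beta (3/4) (1/2 :: real) = 4 * (Gamma (3/4))\<^sup>2 / sqrt (2 * pi)"
    by (simp add: Beta_def Gamma_one_half_real G5)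
qed

lemma hypergeo_half_at_1: "hypergeo_half 1 = (Gamma (1/4))\<^sup>2 / (2 * pi * sqrt (2 * pi))"
proof -
  have "pi / 2 * hypergeo_half 1 = Beta (1/4) (1/2) / 4"
    using integral_hypergeo_half[of 1] integral_unique[OF has_integral_lemniscatic[of 0]] by simp
  then show ?thesis by (simp add: Beta_lemniscatic field_simps)
qed

text \<open>The factor \<open>1 / (n + 1)\<close> arises from the weight \<open>(sin \<theta>)\<^sup>2\<close>: by Wallis, inserting it into the
  integral of \<open>(cos \<theta>) ^ (2 * n)\<close> divides that integral by \<open>2 * (n + 1)\<close>.  The sum is therefore a
  difference of two lemniscatic integrals.\<close>

lemma sums_inverse_Suc:
  "(\<lambda>n. (-1)^n * (half_coeff n)\<^sup>2 * (1 / (real n + 1))) sums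
     (((Gamma (1/4))\<^sup>2 - 4 * (Gamma (3/4))\<^sup>2) / (pi * sqrt (2 * pi)))"
proof -
  let ?w = "\<lambda>\<theta>::real. (sin \<theta>)\<^sup>2" and ?g = "\<lambda>\<theta>::real. (cos \<theta>)\<^sup>2"
  have g01: "?g \<theta> \<in> {0..1}" for \<theta>
    by (auto simp: abs_square_le_1)
  have "(\<lambda>n. (-1)^n * half_coeff n * integral {0..pi/2} (\<lambda>\<theta>. ?w \<theta> * ?g \<theta> ^ n)) sums
          integral {0..pi/2} (\<lambda>\<theta>. ?w \<theta> * alt_series half_coeff (?g \<theta>))"
    by (rule sums_integral_alt_series[OF leibniz_half_coeff]) (use g01 in \<open>auto intro!: continuous_intros\<close>)
  moreover have "integral {0..pi/2} (\<lambda>\<theta>. ?w \<theta> * ?g \<theta> ^ n) = pi / 4 * (half_coeff n / (real n + 1))" for n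
  proof -
    have "((\<lambda>\<theta>. ?g \<theta> ^ n - ?g \<theta> ^ Suc n) has_integral
        (pi / 2 * half_coeff n - pi / 2 * half_coeff (Suc n))) {0..pi/2}"
      by (intro has_integral_diff integral_cos_power_even)
    moreover have "?g \<theta> ^ n - ?g \<theta> ^ Suc n = ?w \<theta> * ?g \<theta> ^ n" for \<theta>
      by (simp add: sin_squared_eq algebra_simps)
    moreover have "pi / 2 * half_coeff n - pi / 2 * half_coeff (Suc n) =
        pi / 4 * (half_coeff n / (real n + 1))"
      by (simp add: half_coeff_Suc divide_simps) (simp add: algebra_simps)
    ultimately show ?thesis by (simp only: integral_unique)
  qed
  moreover have "integral {0..pi/2} (\<lambda>\<theta>. ?w \<theta> * alt_series half_coeff (?g \<theta>)) =
      Beta (1/4) (1/2) / 4 - Beta (3/4) (1/2) / 4"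
  proof -
    have "((\<lambda>\<theta>. cos \<theta> ^ 0 / sqrt (1 + (cos \<theta>)\<^sup>2) - cos \<theta> ^ 2 / sqrt (1 + (cos \<theta>)\<^sup>2))
        has_integral (Beta ((real 0 + 1) / 4) (1/2) / 4 - Beta ((real 2 + 1) / 4) (1/2) / 4)) {0..pi/2}"
      by (intro has_integral_diff has_integral_lemniscatic)
    moreover have "cos \<theta> ^ 0 / sqrt (1 + (cos \<theta>)\<^sup>2) - cos \<theta> ^ 2 / sqrt (1 + (cos \<theta>)\<^sup>2) =
        ?w \<theta> * alt_series half_coeff (?g \<theta>)" for \<theta> :: real
      by (simp add: alt_series_half_coeff[OF g01] sin_squared_eq diff_divide_distrib)
    ultimately show ?thesis by (simp add: integral_unique)
  qed
  ultimately have "(\<lambda>n. (-1)^n * half_coeff n * (pi / 4 * (half_coeff n / (real n + 1)))) sums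
      (Beta (1/4) (1/2) / 4 - Beta (3/4) (1/2) / 4)"
    by simp
  then have "(\<lambda>n. 4 / pi * ((-1)^n * half_coeff n * (pi / 4 * (half_coeff n / (real n + 1))))) sums
      (4 / pi * (Beta (1/4) (1/2) / 4 - Beta (3/4) (1/2) / 4))"
    by (rule sums_mult)
  moreover have "4 / pi * ((-1)^n * half_coeff n * (pi / 4 * (half_coeff n / (real n + 1)))) =
      (-1)^n * (half_coeff n)\<^sup>2 * (1 / (real n + 1))" for n
    by (simp add: power2_eq_square divide_simps)
  moreover have "4 / pi * (Beta (1/4) (1/2) / 4 - Beta (3/4) (1/2) / 4) =
      ((Gamma (1/4))\<^sup>2 - 4 * (Gamma (3/4))\<^sup>2) / (pi * sqrt (2 * pi))"
    by (simp add: Beta_lemniscatic diff_divide_distrib mult_ac)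
  ultimately show ?thesis by (simp only:)
qed

section \<open>The recurrence for even moments\<close>

text \<open>A telescoping form of the hypergeometric differential equation.  Integrating
  \<open>(t (1 + t) f')' = - f / 4\<close> against \<open>t powr (s - 1)\<close> over \<open>[0, 1]\<close> relates the moments at \<open>s\<close>
  and \<open>s - 1\<close> to \<open>f 1\<close> and \<open>f' 1\<close>.  Since the same equation gives \<open>f' 1\<close> as \<open>-1/8\<close> times the
  integral of \<open>f\<close>, which is the sum with denominators \<open>n + 1\<close>, the relation can be written with
  convergent series only.  On the coefficients it becomes a telescoping identity, which holds because
  \<open>(n + 1)\<^sup>2 * (half_coeff (n + 1))\<^sup>2 = (n + 1/2)\<^sup>2 * (half_coeff n)\<^sup>2\<close>.\<close>

lemma contiguous_sums_zero:
  assumes s: "s > 1"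
  shows "(\<lambda>n. (-1)^n * (half_coeff n)\<^sup>2 * ((s - 1/2)\<^sup>2 / (real n + s) + (s - 1)\<^sup>2 / (real n + s - 1)
            - 1/4 / (real n + 1) - 2 * (s - 1))) sums 0"
proof -
  \<comment> \<open>The terms of the series are \<open>- (-1)^n * (d (n + 1) + d n)\<close>.  Without the subtracted \<open>1/4 / (n + 1)\<close>
    the telescoping sequence would have been \<open>n\<^sup>2 * (half_coeff n)\<^sup>2 / (n + s - 1)\<close>, which does not
    tend to \<open>0\<close>.\<close>
  define d where "d n = (half_coeff n)\<^sup>2 * (real n * (s - 1) / (real n + s - 1))" for n
  have d: "0 \<le> d n" "d n \<le> (half_coeff n)\<^sup>2 * (s - 1)" for n
  proof -
    show "0 \<le> d n" using s by (simp add: d_def)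
    have "real n * (s - 1) \<le> (s - 1) * (real n + s - 1)"
      using s mult_nonneg_nonneg[of "s - 1" "s - 1"] by (simp add: algebra_simps)
    then have "real n * (s - 1) / (real n + s - 1) \<le> s - 1"
      using s by (simp add: divide_le_eq)
    then show "d n \<le> (half_coeff n)\<^sup>2 * (s - 1)"
      unfolding d_def by (intro mult_left_mono) auto
  qed
  have "(\<lambda>n. (half_coeff n)\<^sup>2 * (s - 1)) \<longlonglongrightarrow> 0 * (s - 1)"
    using leibniz_half_coeff_squared by (intro tendsto_mult_right) (auto simp: leibniz_coeffs_def)
  then have lim: "(\<lambda>n. (half_coeff n)\<^sup>2 * (s - 1)) \<longlonglongrightarrow> 0" by simp
  have "d \<longlonglongrightarrow> 0"
    by (rule tendsto_sandwich[OF _ _ tendsto_const lim]) (simp_all add: d)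
  then have "(\<lambda>n. (-1)^n * d n) \<longlonglongrightarrow> 0"
    by (intro tendsto_rabs_zero_cancel[of "\<lambda>n. (-1)^n * d n"]) (simp add: abs_mult tendsto_rabs_zero)
  from telescope_sums[OF this]
  have "(\<lambda>n. (-1)^Suc n * d (Suc n) - (-1)^n * d n) sums 0"
    by (simp add: d_def)
  moreover have "(-1)^Suc n * d (Suc n) - (-1)^n * d n =
      (-1)^n * (half_coeff n)\<^sup>2 * ((s - 1/2)\<^sup>2 / (real n + s) + (s - 1)\<^sup>2 / (real n + s - 1)
            - 1/4 / (real n + 1) - 2 * (s - 1))" for n
  proof -
    have nz: "real n + s \<noteq> 0" "real n + s - 1 \<noteq> 0" "real n + 1 \<noteq> 0" using s by auto
    \<comment> \<open>Every numerator is the square of the denominator minus \<open>n + 1/2\<close> (or minus \<open>n\<close>).\<close>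
    have sq: "(p - c)\<^sup>2 / p = p - 2 * c + c\<^sup>2 / p" if "p \<noteq> 0" for p c :: real
      using that by (simp add: power2_eq_square divide_simps) (simp add: algebra_simps)
    have "(s - 1/2)\<^sup>2 / (real n + s) =
        (real n + s) - 2 * (real n + 1/2) + (real n + 1/2)\<^sup>2 / (real n + s)"
      using sq[OF nz(1), of "real n + 1/2"] by simp
    moreover have "(s - 1)\<^sup>2 / (real n + s - 1) =
        (real n + s - 1) - 2 * real n + (real n)\<^sup>2 / (real n + s - 1)"
      using sq[OF nz(2), of "real n"] by simp
    moreover have "1/4 / (real n + 1) =
        (real n + 1) - 2 * (real n + 1/2) + (real n + 1/2)\<^sup>2 / (real n + 1)"
      using sq[OF nz(3), of "real n + 1/2"] by (simp add: power_divide)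
    moreover have "((real n + 1/2) / (real n + 1))\<^sup>2 * ((real n + 1) * (s - 1) / (real n + s)) =
        (real n + 1/2)\<^sup>2 / (real n + 1) - (real n + 1/2)\<^sup>2 / (real n + s)"
    proof -
      have "(c / p)\<^sup>2 * (p * (q - p) / q) = c\<^sup>2 / p - c\<^sup>2 / q" if "p \<noteq> 0" "q \<noteq> 0" for c p q :: real
        using that by (simp add: power2_eq_square divide_simps) (simp add: algebra_simps)
      from this[OF nz(3) nz(1)] show ?thesis by simp
    qed
    moreover have "real n * (s - 1) / (real n + s - 1) = real n - (real n)\<^sup>2 / (real n + s - 1)"
    proof -
      have "x * (q - x) / q = x - x\<^sup>2 / q" if "q \<noteq> 0" for x q :: real
        using that by (simp add: power2_eq_square diff_divide_distrib right_diff_distrib)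
      from this[OF nz(2), of "real n"] show ?thesis by simp
    qed
    ultimately have cert: "((real n + 1/2) / (real n + 1))\<^sup>2 * ((real n + 1) * (s - 1) / (real n + s))
        + real n * (s - 1) / (real n + s - 1) =
      - ((s - 1/2)\<^sup>2 / (real n + s) + (s - 1)\<^sup>2 / (real n + s - 1) - 1/4 / (real n + 1) - 2 * (s - 1))"
      by (simp only:) (simp add: algebra_simps)
    have dSuc: "d (Suc n) = (half_coeff n)\<^sup>2 *
        (((real n + 1/2) / (real n + 1))\<^sup>2 * ((real n + 1) * (s - 1) / (real n + s)))"
    proof -
      have "half_coeff (Suc n) = half_coeff n * ((real n + 1/2) / (real n + 1))"
        by (simp add: half_coeff_Suc divide_simps)
      note step = this
      show ?thesis
        unfolding d_def step power_mult_distrib by (simp add: add_ac)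
    qed
    have "e * (-1) * (h * A) - e * (h * B) = e * h * Z" if "A + B = - Z" for e h A B Z :: real
    proof -
      have "Z = - A - B" using that by simp
      then show ?thesis by (simp only:) (simp add: algebra_simps)
    qed
    from this[OF cert] show ?thesis
      unfolding dSuc by (simp add: d_def)
  qed
  ultimately show ?thesis by simp
qed

text \<open>The preceding identity at \<open>s = l + 3/2\<close>, with the two auxiliary sums evaluated.\<close>

lemma moment_recurrence:
  "(2 * real l + 2)\<^sup>2 * moment (2 * Suc l) + (2 * real l + 1)\<^sup>2 * moment (2 * l) =
     ((4 * real l + 3) * (Gamma (1/4))\<^sup>2 - 4 * (Gamma (3/4))\<^sup>2) / (2 * pi * sqrt (2 * pi))"
proof -
  let ?a = "\<lambda>n. (-1)^n * (half_coeff n)\<^sup>2"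
  let ?s = "real l + 3/2"
  have one: "?a sums hypergeo_half 1"
    using summable_sums[OF alt_series_summable_remainder(1)[OF leibniz_half_coeff_squared, of 1]]
    by (simp add: alt_series_def)
  have "(\<lambda>n. 2 * (real l + 1)\<^sup>2 * (?a n * (1 / (2 * real n + real (2 * Suc l) + 1)))
          + 2 * (real l + 1/2)\<^sup>2 * (?a n * (1 / (2 * real n + real (2 * l) + 1)))
          - 1/4 * (?a n * (1 / (real n + 1))) - (2 * real l + 1) * ?a n)
      sums (2 * (real l + 1)\<^sup>2 * moment (2 * Suc l) + 2 * (real l + 1/2)\<^sup>2 * moment (2 * l)
          - 1/4 * (((Gamma (1/4))\<^sup>2 - 4 * (Gamma (3/4))\<^sup>2) / (pi * sqrt (2 * pi)))
          - (2 * real l + 1) * hypergeo_half 1)"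
    by (intro sums_diff sums_add sums_mult sums_moment sums_inverse_Suc one)
  moreover have "2 * (real l + 1)\<^sup>2 * (?a n * (1 / (2 * real n + real (2 * Suc l) + 1)))
          + 2 * (real l + 1/2)\<^sup>2 * (?a n * (1 / (2 * real n + real (2 * l) + 1)))
          - 1/4 * (?a n * (1 / (real n + 1))) - (2 * real l + 1) * ?a n =
      ?a n * ((?s - 1/2)\<^sup>2 / (real n + ?s) + (?s - 1)\<^sup>2 / (real n + ?s - 1)
            - 1/4 / (real n + 1) - 2 * (?s - 1))" for n
  proof -
    have e: "2 * real n + real (2 * Suc l) + 1 = 2 * (real n + ?s)"
      "2 * real n + real (2 * l) + 1 = 2 * (real n + ?s - 1)"
      "?s - 1/2 = real l + 1" "?s - 1 = real l + 1/2" by (simp_all add: algebra_simps)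
    have "2 * c * (x * (1 / (2 * y))) = x * (c / y)" for c x y :: real by simp
    note cancel = this
    show ?thesis
      unfolding e cancel by (simp add: algebra_simps)
  qed
  ultimately have "(\<lambda>n. ?a n * ((?s - 1/2)\<^sup>2 / (real n + ?s) + (?s - 1)\<^sup>2 / (real n + ?s - 1)
            - 1/4 / (real n + 1) - 2 * (?s - 1)))
      sums (2 * (real l + 1)\<^sup>2 * moment (2 * Suc l) + 2 * (real l + 1/2)\<^sup>2 * moment (2 * l)
          - 1/4 * (((Gamma (1/4))\<^sup>2 - 4 * (Gamma (3/4))\<^sup>2) / (pi * sqrt (2 * pi)))
          - (2 * real l + 1) * hypergeo_half 1)"
    by (simp only:)
  from sums_unique2[OF this contiguous_sums_zero[of ?s]]
  have zero: "2 * (real l + 1)\<^sup>2 * moment (2 * Suc l) + 2 * (real l + 1/2)\<^sup>2 * moment (2 * l)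
          - 1/4 * (((Gamma (1/4))\<^sup>2 - 4 * (Gamma (3/4))\<^sup>2) / (pi * sqrt (2 * pi)))
          - (2 * real l + 1) * hypergeo_half 1 = 0"
    by simp
  have val: "(2 * real l + 1) * hypergeo_half 1
      + 1/4 * (((Gamma (1/4))\<^sup>2 - 4 * (Gamma (3/4))\<^sup>2) / (pi * sqrt (2 * pi)))
    = 1/2 * (((4 * real l + 3) * (Gamma (1/4))\<^sup>2 - 4 * (Gamma (3/4))\<^sup>2) / (2 * pi * sqrt (2 * pi)))"
    by (simp add: hypergeo_half_at_1 divide_simps) (simp add: algebra_simps)
  have sq: "(2 * real l + 2)\<^sup>2 = 4 * (real l + 1)\<^sup>2" "(2 * real l + 1)\<^sup>2 = 4 * (real l + 1/2)\<^sup>2"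
    by (simp_all add: power2_eq_square algebra_simps)
  have "4 * x * y + 4 * z * w = R" if "2 * x * y + 2 * z * w - t - u = 0" "u + t = 1/2 * R"
    for x y z w t u R :: real
    using that by simp
  from this[OF zero val] show ?thesis
    unfolding sq .
qed

text \<open>The solution of the recurrence: \<open>(-1)^l * (half_coeff l)\<^sup>2\<close> solves its homogeneous part, and
  dividing by it turns the recurrence into the summation over \<open>j\<close>.\<close>

lemma moment_even:
  "moment (2 * l) = (-1)^l * (half_coeff l)\<^sup>2 * (moment 0
     - 1 / (8 * sqrt 2 * pi powr (3/2)) * (\<Sum>j=1..l. (-1)^(j-1) / ((real j)\<^sup>2 * (half_coeff j)\<^sup>2)
          * ((4 * real j - 1) * (Gamma (1/4))\<^sup>2 - 4 * (Gamma (3/4))\<^sup>2)))"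
proof (induction l)
  case 0
  show ?case by simp
next
  case (Suc l)
  define C where "C = 1 / (8 * sqrt 2 * pi powr (3/2))"
  define B where "B = (4 * real (Suc l) - 1) * (Gamma (1/4))\<^sup>2 - 4 * (Gamma (3/4))\<^sup>2"
  define X where "X = moment 0 - C * (\<Sum>j=1..l. (-1)^(j-1) / ((real j)\<^sup>2 * (half_coeff j)\<^sup>2)
          * ((4 * real j - 1) * (Gamma (1/4))\<^sup>2 - 4 * (Gamma (3/4))\<^sup>2))"
  have "pi powr (3/2) = pi * sqrt pi"
    using powr_add[of pi 1 "1/2"] by (simp add: powr_half_sqrt)
  then have "B / (2 * pi * sqrt (2 * pi)) = 4 * (C * B)"
    by (simp add: C_def real_sqrt_mult)
  moreover have "B = (4 * real l + 3) * (Gamma (1/4))\<^sup>2 - 4 * (Gamma (3/4))\<^sup>2"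
    by (simp add: B_def)
  ultimately have rec: "(2 * real l + 2)\<^sup>2 * moment (2 * Suc l) =
      4 * (C * B) - (2 * real l + 1)\<^sup>2 * moment (2 * l)"
    using moment_recurrence[of l] by simp
  have nz: "2 * real l + 2 \<noteq> 0" "half_coeff (Suc l) \<noteq> 0" "real (Suc l) \<noteq> 0"
    using half_coeff_pos[of "Suc l"] by auto
  have h: "(2 * real l + 2)\<^sup>2 * (half_coeff (Suc l))\<^sup>2 = (2 * real l + 1)\<^sup>2 * (half_coeff l)\<^sup>2"
    using nz(1) by (simp add: half_coeff_Suc mult.commute flip: power_mult_distrib)
  have "(2 * real l + 2)\<^sup>2 * ((-1)^Suc l * (half_coeff (Suc l))\<^sup>2 *
      (X - C * ((-1)^l / ((real (Suc l))\<^sup>2 * (half_coeff (Suc l))\<^sup>2) * B))) =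
      - ((-1)^l) * ((2 * real l + 2)\<^sup>2 * (half_coeff (Suc l))\<^sup>2) * X
      + C * B * ((-1)^l * (-1)^l) * ((half_coeff (Suc l))\<^sup>2 * (2 * real l + 2)\<^sup>2
          / ((real (Suc l))\<^sup>2 * (half_coeff (Suc l))\<^sup>2))"
    by (simp add: algebra_simps)
  also have "(half_coeff (Suc l))\<^sup>2 * (2 * real l + 2)\<^sup>2 / ((real (Suc l))\<^sup>2 * (half_coeff (Suc l))\<^sup>2) = 4"
    using nz by (simp add: divide_simps) (simp add: power2_eq_square algebra_simps)
  also have "(-1)^l * (-1)^l = (1::real)"
    by (simp flip: power_mult_distrib)
  also have "- ((-1)^l) * ((2 * real l + 2)\<^sup>2 * (half_coeff (Suc l))\<^sup>2) * X + C * B * 1 * 4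
      = 4 * (C * B) - (2 * real l + 1)\<^sup>2 * ((-1)^l * (half_coeff l)\<^sup>2 * X)"
    unfolding h by (simp add: algebra_simps)
  also have "(-1)^l * (half_coeff l)\<^sup>2 * X = moment (2 * l)"
    using Suc by (simp only: X_def C_def)
  finally have "(2 * real l + 2)\<^sup>2 * ((-1)^Suc l * (half_coeff (Suc l))\<^sup>2 *
      (X - C * ((-1)^l / ((real (Suc l))\<^sup>2 * (half_coeff (Suc l))\<^sup>2) * B))) =
      (2 * real l + 2)\<^sup>2 * moment (2 * Suc l)"
    using rec by simp
  moreover have "(2 * real l + 2)\<^sup>2 \<noteq> 0"
    using nz(1) by simp
  ultimately have "moment (2 * Suc l) = (-1)^Suc l * (half_coeff (Suc l))\<^sup>2 *
      (X - C * ((-1)^l / ((real (Suc l))\<^sup>2 * (half_coeff (Suc l))\<^sup>2) * B))"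
    by (metis mult_left_cancel)
  also have "X - C * ((-1)^l / ((real (Suc l))\<^sup>2 * (half_coeff (Suc l))\<^sup>2) * B) =
      moment 0 - C * (\<Sum>j=1..Suc l. (-1)^(j-1) / ((real j)\<^sup>2 * (half_coeff j)\<^sup>2)
          * ((4 * real j - 1) * (Gamma (1/4))\<^sup>2 - 4 * (Gamma (3/4))\<^sup>2))"
    unfolding X_def B_def by (simp add: sum.nat_ivl_Suc' distrib_left del: of_nat_Suc)
  finally show ?case unfolding C_def .
qed

section \<open>Series, elliptic integral and even moments\<close>

theorem theorem3p8:
  fixes m :: nat and \<Phi> :: real
  assumes "\<Phi> = integral {0..1} (\<lambda>x::real. x powr (-1/2) * hypergeo_2F1 (1/2) (1/2) 1 (-x))"
  shows
    "(\<lambda>n. (-1)^n * (1 / 16^n) * (real ((2*n) choose n))\<^sup>2 * (1 / (2 * real n + real m + 1)))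
       sums (2 / pi * integral {0..1}
               (\<lambda>x::real. x^m / sqrt (1 + x\<^sup>2) * elliptic_K (x / sqrt (1 + x\<^sup>2))))
     \<and> (\<forall>l::nat. m = 2*l + 1 \<longrightarrow>
          summable (\<lambda>n. (-1)^n * (1 / 16^n) * (real ((2*n) choose n))\<^sup>2 * (1 / (real n + real l + 1)))
          \<and> (\<Sum>n. (-1)^n * (1 / 16^n) * (real ((2*n) choose n))\<^sup>2 * (1 / (2 * real n + real m + 1)))
            = 1 / 2 * (\<Sum>n. (-1)^n * (1 / 16^n) * (real ((2*n) choose n))\<^sup>2 * (1 / (real n + real l + 1))))
     \<and> (\<forall>l::nat. m = 2*l \<longrightarrow>
          (\<Sum>n. (-1)^n * (1 / 16^n) * (real ((2*n) choose n))\<^sup>2 * (1 / (2 * real n + 2 * real l + 1)))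
            = (-1)^l * (real ((2*l) choose l))\<^sup>2 / 16^l
              * (1 / 2 * \<Phi>
                 - 1 / (8 * sqrt 2 * pi powr (3/2))
                   * (\<Sum>j=1..l. (-1)^(j-1) * (16^j / ((real j)\<^sup>2 * (real ((2*j) choose j))\<^sup>2))
                        * ((4 * real j - 1) * (Gamma (1/4))\<^sup>2 - 4 * (Gamma (3/4))\<^sup>2))))"
proof -
  have coeff: "(-1)^n * (1 / 16^n) * (real ((2*n) choose n))\<^sup>2 = (-1)^n * (half_coeff n)\<^sup>2" for n
    by (simp add: half_coeff_squared)
  have K: "2 / pi * integral {0..1} (\<lambda>x::real. x^m / sqrt (1 + x\<^sup>2) * elliptic_K (x / sqrt (1 + x\<^sup>2))) =
      moment m"
  proof -
    have "integral {0..1} (\<lambda>x::real. x^m / sqrt (1 + x\<^sup>2) * elliptic_K (x / sqrt (1 + x\<^sup>2))) =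
        integral {0..1} (\<lambda>x. pi / 2 * (x ^ m * hypergeo_half (x\<^sup>2)))"
    proof (rule integral_cong)
      fix x :: real assume x: "x \<in> {0..1}"
      have "x^m / sqrt (1 + x\<^sup>2) * elliptic_K (x / sqrt (1 + x\<^sup>2)) =
          x^m * (elliptic_K (x / sqrt (1 + x\<^sup>2)) / sqrt (1 + x\<^sup>2))" by simp
      then show "x^m / sqrt (1 + x\<^sup>2) * elliptic_K (x / sqrt (1 + x\<^sup>2)) =
          pi / 2 * (x ^ m * hypergeo_half (x\<^sup>2))"
        unfolding elliptic_K_eq_hypergeo_half[OF x] by simp
    qed
    also have "\<dots> = pi / 2 * moment m"
      unfolding moment_def by (rule integral_mult_right)
    finally show ?thesis by (simp only:) simp
  qed
  have \<Phi>: "moment 0 = 1 / 2 * \<Phi>"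
    unfolding assms hypergeo_2F1_eq integral_powr_hypergeo_half by simp
  have odd: "summable (\<lambda>n. (-1)^n * (half_coeff n)\<^sup>2 * (1 / (real n + real l + 1)))"
    "moment (2 * l + 1) = 1 / 2 * (\<Sum>n. (-1)^n * (half_coeff n)\<^sup>2 * (1 / (real n + real l + 1)))" for l
  proof -
    have "2 * ((-1)^n * (half_coeff n)\<^sup>2 * (1 / (2 * real n + real (2 * l + 1) + 1))) =
        (-1)^n * (half_coeff n)\<^sup>2 * (1 / (real n + real l + 1))" for n
    proof -
      have "2 * real n + real (2 * l + 1) + 1 = 2 * (real n + real l + 1)" by simp
      moreover have "2 * (x * (1 / (2 * y))) = x * (1 / y)" for x y :: real by simp
      ultimately show ?thesis by (simp only:)
    qed
    then have "(\<lambda>n. (-1)^n * (half_coeff n)\<^sup>2 * (1 / (real n + real l + 1))) sums (2 * moment (2 * l + 1))"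
      using sums_mult[OF sums_moment[of "2 * l + 1"], of 2] by (simp only:)
    then show "summable (\<lambda>n. (-1)^n * (half_coeff n)\<^sup>2 * (1 / (real n + real l + 1)))"
      "moment (2 * l + 1) = 1 / 2 * (\<Sum>n. (-1)^n * (half_coeff n)\<^sup>2 * (1 / (real n + real l + 1)))"
      by (simp_all add: sums_iff)
  qed
  have even: "(\<Sum>n. (-1)^n * (half_coeff n)\<^sup>2 * (1 / (2 * real n + 2 * real l + 1))) =
      (-1)^l * (real ((2*l) choose l))\<^sup>2 / 16^l
              * (1 / 2 * \<Phi>
                 - 1 / (8 * sqrt 2 * pi powr (3/2))
                   * (\<Sum>j=1..l. (-1)^(j-1) * (16^j / ((real j)\<^sup>2 * (real ((2*j) choose j))\<^sup>2))
                        * ((4 * real j - 1) * (Gamma (1/4))\<^sup>2 - 4 * (Gamma (3/4))\<^sup>2)))" for l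
  proof -
    have "(\<Sum>n. (-1)^n * (half_coeff n)\<^sup>2 * (1 / (2 * real n + 2 * real l + 1))) = moment (2 * l)"
      using sums_moment[of "2 * l"] by (simp add: sums_iff)
    then show ?thesis
      unfolding moment_even \<Phi> by (simp add: half_coeff_squared)
  qed
  show ?thesis
    unfolding coeff K
    using sums_moment[of m] odd even by (auto simp: sums_iff)
qed

end
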